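(* Let $\alpha\in[0,1)$ and let $G\in Path[\mathbf{x},\mathbf{b}]$ be an optimal allocation path from $\mathbf{x}$ to $\mathbf{b}$. Then, for any $i\ne s\in\{1,\dots,k\}$, $x_i$ and $x_s$ do not belong to the same connected component of $G$.
   Context: $X\subset\mathbb{R}^m$ is compact and convex, $\mathbf{x}=\{x_1,\dots,x_k\}\subset X$ is a set of $k$ points, $\mathbf{b}=\sum_{j=1}^\ell n_j\delta_{y_j}$ with $y_j\in X$, $n_j>0$, $\sum_jn_j=1$. Transport paths. For atomic probability measures $\mathbf{a}=\sum_{i=1}^km_i\delta_{x_i}$ ($m_i\ge0$) and $\mathbf{b}$, a transport path from $\mathbf{a}$ to $\mathbf{b}$ is a weighted directed graph $G$ with a finite vertex set $V(G)\supseteq\{x_1,\dots,x_k\}\cup\{y_1,\dots,y_\ell\}$, a finite set $E(G)$ of directed edges, each edge $e$ a line segment from $e^-$ to $e^+$, and weights $w:E(G)\to(0,\infty)$ such that for every $v\in V(G)$, $\sum_{e^-=v}w(e)=\sum_{e^+=v}w(e)+\mathbf{a}(\{v\})-\mathbf{b}(\{v\})$ (i.e. $\partial G=\mathbf{b}-\mathbf{a}$ when $G$ is viewed as a one-dimensional polyhedral chain). By standing convention transport paths contain no cycles. $Path(\mathbf{a},\mathbf{b})$ is the set of all of them, and $\mathbf{M}_\alpha(G)=\sum_{e\in E(G)}w(e)^\alpha\,length(e)$. An allocation path from $\mathbf{x}$ to $\mathbf{b}$ is an element of $Path(\mathbf{a},\mathbf{b})$ for some atomic probability measure $\mathbf{a}$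 supported on $\mathbf{x}$; the set of these is $Path[\mathbf{x},\mathbf{b}]$. It is optimal if it minimizes $\mathbf{M}_\alpha$ over $Path[\mathbf{x},\mathbf{b}]$. Connected components of $G$ are taken regardless of edge directions. *)

theory Defs
  imports
    "HOL-Analysis.Analysis"
    "Graph_Theory.Digraph_Component"
    "Graph_Theory.Weighted_Graph"
begin

text \<open>
  A directed edge is the ordered pair of its endpoints \<open>(e\<^sup>-, e\<^sup>+)\<close>, read as the oriented
  segment between them. Only the values of the weight function on the edges matter.
\<close>

type_synonym 'a weighted_digraph = "'a pair_pre_digraph \<times> ('a \<times> 'a) weight_fun"

text \<open>
  An atomic measure \<open>\<Sum>i=1..k. m i \<cdot> \<delta> (p i)\<close> enters only through the masses it gives to
  points: this is the mass of \<open>{v}\<close>. The points \<open>p i\<close> need not be distinct.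
\<close>

definition atomic_mass :: "nat \<Rightarrow> (nat \<Rightarrow> real) \<Rightarrow> (nat \<Rightarrow> 'a) \<Rightarrow> 'a \<Rightarrow> real" where
  "atomic_mass k m p v = (\<Sum>i = 1..k. m i * indicat_real {v} (p i))"

definition probability_weights :: "nat \<Rightarrow> (nat \<Rightarrow> real) \<Rightarrow> bool" where
  "probability_weights k m \<longleftrightarrow> (\<forall>i \<in> {1..k}. m i \<ge> 0) \<and> (\<Sum>i = 1..k. m i) = 1"

text \<open>
  Cycles disregard edge directions (the library's \<open>cycle\<close> and \<open>forest\<close> do not), so that an
  acyclic graph is a disjoint union of trees. A cycle has distinct vertices
  \<open>v\<^sub>0, \<dots>, v\<^sub>r\<close> and distinct edges, the \<open>i\<close>-th one joining \<open>v\<^sub>i\<close> and its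
  cyclic successor in one of the two directions. Length 1 is a loop, i.e. a degenerate segment,
  and length 2 a pair of opposite edges; for larger lengths distinctness of the edges is automatic.
\<close>

definition has_undirected_cycle :: "'a pair_pre_digraph \<Rightarrow> bool" where
  "has_undirected_cycle G \<longleftrightarrow>
    (\<exists>vs es. vs \<noteq> [] \<and> length es = length vs \<and> distinct vs \<and> distinct es \<and>
      set es \<subseteq> parcs G \<and>
      (\<forall>i < length vs.
        es ! i = (vs ! i, vs ! (Suc i mod length vs)) \<or>
        es ! i = (vs ! (Suc i mod length vs), vs ! i)))"

text \<open>\<open>Path(a, b)\<close> for \<open>a = \<Sum>i=1..k. m i \<cdot> \<delta> (x i)\<close> and \<open>b = \<Sum>j=1..l. n j \<cdot> \<delta> (y j)\<close>.\<close>

definition transport_paths ::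
  "nat \<Rightarrow> (nat \<Rightarrow> real) \<Rightarrow> (nat \<Rightarrow> 'a) \<Rightarrow> nat \<Rightarrow> (nat \<Rightarrow> real) \<Rightarrow> (nat \<Rightarrow> 'a) \<Rightarrow> 'a weighted_digraph set"
where
  "transport_paths k m x l n y = {(G, w).
     pair_fin_digraph G \<and>
     x ` {1..k} \<union> y ` {1..l} \<subseteq> pverts G \<and>
     (\<forall>e \<in> parcs G. w e > 0) \<and>
     (\<forall>v \<in> pverts G.
        (\<Sum>e \<in> out_arcs G v. w e)
          = (\<Sum>e \<in> in_arcs G v. w e) + atomic_mass k m x v - atomic_mass l n y v) \<and>
     \<not> has_undirected_cycle G}"

definition M_cost :: "real \<Rightarrow> 'a::metric_space weighted_digraph \<Rightarrow> real" where
  "M_cost \<alpha> = (\<lambda>(G, w). \<Sum>e \<in> parcs G. w e powr \<alpha> * dist (fst e) (snd e))"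

text \<open>\<open>Path[x, b]\<close>: the initial measure is any probability measure supported on the \<open>x i\<close>.\<close>

definition allocation_paths ::
  "nat \<Rightarrow> (nat \<Rightarrow> 'a) \<Rightarrow> nat \<Rightarrow> (nat \<Rightarrow> real) \<Rightarrow> (nat \<Rightarrow> 'a) \<Rightarrow> 'a weighted_digraph set"
where
  "allocation_paths k x l n y =
    (\<Union>m \<in> {m. probability_weights k m}. transport_paths k m x l n y)"

definition optimal_allocation_path ::
  "real \<Rightarrow> nat \<Rightarrow> (nat \<Rightarrow> 'a::metric_space) \<Rightarrow> nat \<Rightarrow> (nat \<Rightarrow> real) \<Rightarrow> (nat \<Rightarrow> 'a)
    \<Rightarrow> 'a weighted_digraph \<Rightarrow> bool"
where
  "optimal_allocation_path \<alpha> k x l n y P \<longleftrightarrow>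
    P \<in> allocation_paths k x l n y \<and>
    (\<forall>Q \<in> allocation_paths k x l n y. M_cost \<alpha> P \<le> M_cost \<alpha> Q)"

text \<open>The edges are symmetrised first, so strong components are the undirected ones.\<close>

definition connected_components :: "'a pair_pre_digraph \<Rightarrow> 'a set set" where
  "connected_components G = pre_digraph.sccs_verts (with_proj (mk_symmetric (with_proj G)))"

end

theory Submission
  imports Defs
begin

text \<open>
  Reweight the edges of \<open>G\<close> by adding a chain \<open>c\<close> whose boundary moves mass from one source to
  another; by optimality this never lowers the cost. Every source point meeting an edge
  has some positive source upstream, since otherwise the flow upstream of it is a closed
  circulation, which can be deleted. For \<open>\<alpha> > 0\<close>, a massless source \<open>x i\<close> could take over part
  of the flow reaching it from upstream, which lowers the cost; so two connected sources both
  carry mass, and moving mass along \<open>\<plusminus>c\<close> contradicts strict concavity of \<open>t powr \<alpha>\<close>.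
  For \<open>\<alpha> = 0\<close> the cost is the total length of the used edges, so all mass of the component can be moved
  to \<open>x i\<close>, or to \<open>x s\<close>, without any edge changing its direction. Hence there are directed paths
  both from \<open>x i\<close> to \<open>x s\<close> and back, and the resulting circulation can be reduced until an edge
  vanishes.
\<close>

section \<open>Strict concavity of powers\<close>

text \<open>Weighted AM-GM for \<open>u\<close> and 1: with \<open>L\<close> the right-hand side,
  \<open>ln z \<le> z - 1\<close> is applied at \<open>u / L\<close> and \<open>1 / L\<close> with
  weights \<open>\<alpha>\<close> and \<open>1 - \<alpha>\<close>. The bounds add up to 0 because
  \<open>L\<close> is the weighted mean, and \<open>L \<noteq> 1\<close> makes the second one
  strict.\<close>

lemma powr_less_tangent:
  fixes u \<alpha> :: real
  assumes "0 < \<alpha>" "\<alpha> < 1" "0 \<le> u" "u \<noteq> 1"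
  shows "u powr \<alpha> < 1 + \<alpha> * (u - 1)"
proof (cases "u = 0")
  case True
  then show ?thesis using assms by simp
next
  case False
  define L where "L = 1 + \<alpha> * (u - 1)"
  have u: "u > 0" using False assms by simp
  have L: "L > 0"
  proof -
    have "L = (1 - \<alpha>) + \<alpha> * u" by (simp add: L_def algebra_simps)
    then show ?thesis using assms u by (simp add: add_pos_pos)
  qed
  have "L \<noteq> 1" using assms by (simp add: L_def)
  then have "ln (1 / L) < 1 / L - 1"
    using ln_le_minus_one[of "1 / L"] ln_eq_minus_one[of "1 / L"] L
    by (force simp: less_le)
  then have 1: "(1 - \<alpha>) * ln (1 / L) < (1 - \<alpha>) * (1 / L - 1)"
    using assms by (intro mult_strict_left_mono) auto
  have 2: "\<alpha> * ln (u / L) \<le> \<alpha> * (u / L - 1)"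
    using assms u L ln_le_minus_one[of "u / L"] by (intro mult_left_mono) auto
  have "\<alpha> * (u / L - 1) + (1 - \<alpha>) * (1 / L - 1) = (1 + \<alpha> * (u - 1)) / L - 1"
    using L by (simp add: field_simps)
  also have "\<dots> = 0" using L by (simp add: L_def)
  finally have "\<alpha> * ln u - ln L < 0"
    using 1 2 u L by (simp add: ln_div algebra_simps)
  then have "exp (\<alpha> * ln u) < exp (ln L)" by (simp only: exp_less_cancel_iff)
  then have "u powr \<alpha> < L" using u L by (simp only: powr_def exp_ln) simp
  then show ?thesis by (simp only: L_def)
qed

text \<open>Dividing by \<open>a\<close> reduces this to the tangent bound at 1; the linear terms
  for \<open>d\<close> and \<open>- d\<close> cancel. The bound holds at \<open>u = 0\<close>, which
  covers \<open>\<bar>d\<bar> = a\<close>.\<close>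

lemma powr_midpoint_less:
  fixes a d \<alpha> :: real
  assumes "0 < \<alpha>" "\<alpha> < 1" "0 < a" "\<bar>d\<bar> \<le> a" "d \<noteq> 0"
  shows "(a + d) powr \<alpha> + (a - d) powr \<alpha> < 2 * a powr \<alpha>"
proof -
  have *: "(a + h) powr \<alpha> < a powr \<alpha> * (1 + \<alpha> * (h / a))" if "\<bar>h\<bar> \<le> a" "h \<noteq> 0" for h
  proof -
    have "(1 + h / a) powr \<alpha> < 1 + \<alpha> * ((1 + h / a) - 1)"
      using assms that by (intro powr_less_tangent) (auto simp: field_simps)
    then have "a powr \<alpha> * (1 + h / a) powr \<alpha> < a powr \<alpha> * (1 + \<alpha> * (h / a))"
      using assms by simp
    moreover have "a powr \<alpha> * (1 + h / a) powr \<alpha> = (a * (1 + h / a)) powr \<alpha>"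
      by (simp add: powr_mult)
    moreover have "a * (1 + h / a) = a + h" using assms by (simp add: field_simps)
    ultimately show ?thesis by simp
  qed
  show ?thesis using *[of d] *[of "- d"] assms by (simp add: algebra_simps)
qed

section \<open>Step sizes along a perturbation\<close>

text \<open>Ratio test: the first decreasing coordinate to reach 0 does so at the least
  \<open>w e / - c e\<close> with \<open>c e < 0\<close>, and \<open>e0\<close> shows that this
  happens by time \<open>T\<close>.\<close>

lemma exists_step_to_boundary:
  fixes w c :: "'b \<Rightarrow> real"
  assumes "finite E" "\<And>e. e \<in> E \<Longrightarrow> w e > 0" "e0 \<in> E" "w e0 + T * c e0 \<le> 0" "T \<ge> 0"
  obtains t e where "0 < t" "t \<le> T" "\<And>e. e \<in> E \<Longrightarrow> w e + t * c e \<ge> 0" "e \<in> E" "w e + t * c e = 0"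
proof -
  define N where "N = {e \<in> E. c e < 0}"
  have "c e0 < 0"
  proof (rule ccontr)
    assume "\<not> ?thesis"
    then have "T * c e0 \<ge> 0" using assms by simp
    then show False using assms(2)[OF \<open>e0 \<in> E\<close>] assms(4) by linarith
  qed
  then have N: "finite N" "e0 \<in> N" using assms by (auto simp: N_def)
  define t where "t = Min ((\<lambda>e. w e / - c e) ` N)"
  have "t \<in> (\<lambda>e. w e / - c e) ` N" unfolding t_def using N by (intro Min_in) auto
  then obtain e where e: "e \<in> N" "t = w e / - c e" by blast
  have le: "t \<le> w f / - c f" if "f \<in> N" for f unfolding t_def using N that by (intro Min_le) auto
  show ?thesis
  proof (rule that[of t e])
    show "0 < t" using e assms(2)[of e] by (simp add: N_def divide_pos_neg)
    have "w e0 / - c e0 \<le> T" using assms(4) \<open>c e0 < 0\<close> by (simp add: field_simps)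
    then show "t \<le> T" using le[OF N(2)] by simp
    show "e \<in> E" using e by (simp add: N_def)
    show "w e + t * c e = 0" using e by (simp add: N_def)
    fix f assume f: "f \<in> E"
    show "w f + t * c f \<ge> 0"
    proof (cases "c f < 0")
      case True
      then show ?thesis using le[of f] f by (simp add: N_def field_simps)
    next
      case False
      then have "t * c f \<ge> 0" using \<open>0 < t\<close> by simp
      then show ?thesis using assms(2)[OF f] by linarith
    qed
  qed
qed

lemma exists_small_step:
  fixes w c :: "'b \<Rightarrow> real"
  assumes "finite E" "\<And>e. e \<in> E \<Longrightarrow> w e > 0" "T > 0"
  obtains t where "0 < t" "t \<le> T" "\<And>e. e \<in> E \<Longrightarrow> t * \<bar>c e\<bar> \<le> w e"
proof -
  \<comment> \<open>The summand 1 avoids division by zero; \<open>T\<close> caps the step and keeps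
    the set nonempty.\<close>
  define S where "S = insert T ((\<lambda>e. w e / (1 + \<bar>c e\<bar>)) ` E)"
  have S: "finite S" "S \<noteq> {}" using assms by (auto simp: S_def)
  show ?thesis
  proof (rule that[of "Min S"])
    have "\<forall>s\<in>S. 0 < s"
      using assms by (auto simp: S_def intro!: divide_pos_pos add_pos_nonneg)
    then show pos: "0 < Min S" using S by simp
    show "Min S \<le> T" using S by (intro Min_le) (auto simp: S_def)
    fix e assume e: "e \<in> E"
    have "Min S \<le> w e / (1 + \<bar>c e\<bar>)" using S e by (intro Min_le) (auto simp: S_def)
    then have "Min S * (1 + \<bar>c e\<bar>) \<le> w e" by (simp add: field_simps)
    then show "Min S * \<bar>c e\<bar> \<le> w e" using pos by (simp add: algebra_simps)
  qed
qed

section \<open>Chains on a digraph and their boundaries\<close>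

text \<open>With the boundary of an edge taken as head minus tail, this is minus the boundary of the
  chain \<open>c\<close>; coefficients may be negative.\<close>

definition netflow :: "('a \<times> 'a) set \<Rightarrow> ('a \<times> 'a \<Rightarrow> real) \<Rightarrow> 'a \<Rightarrow> real" where
  "netflow E c v = (\<Sum>e \<in> {e \<in> E. fst e = v}. c e) - (\<Sum>e \<in> {e \<in> E. snd e = v}. c e)"

lemma netflow_add: "netflow E (\<lambda>e. c e + d e) v = netflow E c v + netflow E d v"
  by (simp add: netflow_def sum.distrib)

lemma netflow_scale: "netflow E (\<lambda>e. t * c e) v = t * netflow E c v"
  by (simp add: netflow_def sum_distrib_left right_diff_distrib)

lemma netflow_indicator:
  assumes "finite E" "(a, b) \<in> E"
  shows "netflow E (indicat_real {(a, b)}) v = indicat_real {a} v - indicat_real {b} v"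
proof -
  have "sum (indicat_real {(a, b)}) {e \<in> E. P e} = (if P (a, b) then 1 else 0)" for P
  proof -
    have "sum (indicat_real {(a, b)}) {e \<in> E. P e} = (\<Sum>e \<in> {e \<in> E. P e}. if (a, b) = e then 1 else 0)"
      by (intro sum.cong) (auto simp: indicator_def)
    also have "\<dots> = (if P (a, b) then 1 else 0)" using assms by (simp add: sum.delta)
    finally show ?thesis .
  qed
  then show ?thesis by (simp add: netflow_def indicator_def)
qed

text \<open>Sum the edges along a walk, with sign -1 for each edge crossed against its
  direction.\<close>

lemma undirected_path_chain:
  assumes "finite E" "(u, v) \<in> (E \<union> E\<inverse>)\<^sup>*"
  obtains c where "\<And>z. netflow E c z = indicat_real {u} z - indicat_real {v} z"
  using assms(2)
proof (induction arbitrary: thesis rule: rtrancl_induct)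
  case base
  show ?case by (rule base[of "\<lambda>_. 0"]) (simp add: netflow_def)
next
  case (step a b)
  obtain c where c: "\<And>z. netflow E c z = indicat_real {u} z - indicat_real {a} z"
    using step.IH by blast
  consider "(a, b) \<in> E" | "(b, a) \<in> E" using step.hyps by blast
  then show ?case
  proof cases
    case 1
    show ?thesis
      by (rule step.prems[of "\<lambda>e. c e + indicat_real {(a, b)} e"])
        (simp add: netflow_add c netflow_indicator[OF assms(1) 1])
  next
    case 2
    show ?thesis
      by (rule step.prems[of "\<lambda>e. c e + (- 1) * indicat_real {(b, a)} e"])
        (simp only: netflow_add netflow_scale c netflow_indicator[OF assms(1) 2], simp)
  qed
qed

text \<open>On a directed walk no sign -1 occurs, so the chain is nonnegative.\<close>

lemma directed_path_chain:
  assumes "finite E" "(u, v) \<in> E\<^sup>*"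
  obtains c where "\<And>e. c e \<ge> 0" "\<And>z. netflow E c z = indicat_real {u} z - indicat_real {v} z"
  using assms(2)
proof (induction arbitrary: thesis rule: rtrancl_induct)
  case base
  show ?case by (rule base[of "\<lambda>_. 0"]) (simp_all add: netflow_def)
next
  case (step a b)
  obtain c where c: "\<And>e. c e \<ge> 0" "\<And>z. netflow E c z = indicat_real {u} z - indicat_real {a} z"
    using step.IH by blast
  show ?case
    by (rule step.prems[of "\<lambda>e. c e + indicat_real {(a, b)} e"])
      (simp_all add: netflow_add c netflow_indicator[OF assms(1) step.hyps(2)])
qed

lemma netflow_nonzeroE:
  assumes "netflow E c z \<noteq> 0"
  obtains e where "e \<in> E" "c e \<noteq> 0"
proof -
  have "netflow E c z = 0" if "\<forall>e\<in>E. c e = 0"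
    using that by (simp add: netflow_def)
  then show ?thesis using assms that by blast
qed

section \<open>Moving mass between sources\<close>

definition transfer :: "nat \<Rightarrow> nat \<Rightarrow> real \<Rightarrow> (nat \<Rightarrow> real) \<Rightarrow> nat \<Rightarrow> real" where
  "transfer i p t m = m(i := m i + t, p := m p - t)"

lemma transfer_eq:
  "i \<noteq> p \<Longrightarrow> transfer i p t m = (\<lambda>j. m j + t * (indicat_real {i} j - indicat_real {p} j))"
  by (auto simp: transfer_def indicator_def)

text \<open>Taking \<open>f\<close> constantly 1 gives conservation of total mass; taking an
  indicator gives the change of the atomic measure.\<close>

lemma sum_transfer:
  assumes "finite K" "i \<in> K" "p \<in> K" "i \<noteq> p"
  shows "(\<Sum>j\<in>K. transfer i p t m j * f j) = (\<Sum>j\<in>K. m j * f j) + t * (f i - f p)"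
proof -
  have *: "(\<Sum>j\<in>K. indicat_real {q} j * f j) = f q" if "q \<in> K" for q
  proof -
    have "(\<Sum>j\<in>K. indicat_real {q} j * f j) = (\<Sum>j\<in>K. if q = j then f j else 0)"
      by (intro sum.cong) (auto simp: indicator_def)
    then show ?thesis using assms(1) that by simp
  qed
  have "(\<Sum>j\<in>K. transfer i p t m j * f j)
      = (\<Sum>j\<in>K. m j * f j) + t * ((\<Sum>j\<in>K. indicat_real {i} j * f j) - (\<Sum>j\<in>K. indicat_real {p} j * f j))"
    using assms(4)
    by (simp add: transfer_eq sum.distrib sum_distrib_left sum_subtractf algebra_simps)
  then show ?thesis using * assms by simp
qed

lemma probability_weights_transfer:
  assumes "probability_weights k m" "i \<in> {1..k}" "p \<in> {1..k}" "i \<noteq> p"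
    "m i + t \<ge> 0" "m p - t \<ge> 0"
  shows "probability_weights k (transfer i p t m)"
  using assms sum_transfer[of "{1..k}" i p t m "\<lambda>_. 1"]
  by (auto simp: probability_weights_def transfer_def)

lemma atomic_mass_transfer:
  assumes "i \<in> {1..k}" "p \<in> {1..k}" "i \<noteq> p"
  shows "atomic_mass k (transfer i p t m) x v
    = atomic_mass k m x v + t * (indicat_real {x i} v - indicat_real {x p} v)"
proof -
  have "indicat_real {v} (x j) = indicat_real {x j} v" for j by (auto simp: indicator_def)
  then show ?thesis unfolding atomic_mass_def
    using sum_transfer[OF finite_atLeastAtMost assms, of t m "\<lambda>j. indicat_real {x j} v"] by simp
qed

section \<open>Optimal flows on a fixed edge set\<close>

text \<open>The graph is frozen and only weights and source masses vary. Subgraphs of an acyclic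
  graph are acyclic, so competitors found here translate back into transport paths.\<close>

locale allocation_network =
  fixes V :: "'a set" and E :: "('a \<times> 'a) set" and len :: "'a \<times> 'a \<Rightarrow> real"
    and \<alpha> :: real and k :: nat and x :: "nat \<Rightarrow> 'a" and B :: "'a \<Rightarrow> real"
  assumes finite_V: "finite V" and finite_E: "finite E" and E_subset: "E \<subseteq> V \<times> V"
    and len_pos: "e \<in> E \<Longrightarrow> len e > 0"
    and alpha: "0 \<le> \<alpha>" "\<alpha> < 1"
    and inj_x: "inj_on x {1..k}" and x_V: "x ` {1..k} \<subseteq> V"
    and B_nonneg: "B v \<ge> 0"
begin

text \<open>Weight 0 is allowed and stands for a deleted edge.\<close>

definition feasible :: "(nat \<Rightarrow> real) \<Rightarrow> ('a \<times> 'a \<Rightarrow> real) \<Rightarrow> bool" where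
  "feasible m f \<longleftrightarrow> probability_weights k m \<and> (\<forall>e\<in>E. f e \<ge> 0) \<and>
    (\<forall>v\<in>V. netflow E f v = atomic_mass k m x v - B v)"

text \<open>Edges of weight 0 are free also for \<open>\<alpha> = 0\<close>, since \<open>0 powr 0 = 0\<close>.\<close>

definition cost :: "('a \<times> 'a \<Rightarrow> real) \<Rightarrow> real" where
  "cost f = (\<Sum>e\<in>E. f e powr \<alpha> * len e)"

text \<open>Strict positivity says that every edge of \<open>E\<close> is really used, so that a
  competitor with a vanishing edge saves something.\<close>

definition optimal :: "(nat \<Rightarrow> real) \<Rightarrow> ('a \<times> 'a \<Rightarrow> real) \<Rightarrow> bool" where
  "optimal m f \<longleftrightarrow> feasible m f \<and> (\<forall>e\<in>E. f e > 0) \<and> (\<forall>m' f'. feasible m' f' \<longrightarrow> cost f \<le> cost f')"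

text \<open>The chain changes the netflow by exactly the mass gained at \<open>x i\<close> and lost
  at \<open>x p\<close>, so the balance equations persist.\<close>

lemma feasible_transfer:
  assumes "feasible m f" "i \<in> {1..k}" "p \<in> {1..k}" "i \<noteq> p"
    and "\<And>z. netflow E c z = indicat_real {x i} z - indicat_real {x p} z"
    and "\<And>e. e \<in> E \<Longrightarrow> f e + t * c e \<ge> 0" "m i + t \<ge> 0" "m p - t \<ge> 0"
  shows "feasible (transfer i p t m) (\<lambda>e. f e + t * c e)"
proof -
  have "netflow E (\<lambda>e. f e + t * c e) v = atomic_mass k (transfer i p t m) x v - B v"
    if "v \<in> V" for v
    using assms(1,5) that unfolding netflow_add netflow_scale atomic_mass_transfer[OF assms(2-4)]
    by (simp add: feasible_def)
  moreover have "probability_weights k (transfer i p t m)"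
    using assms by (intro probability_weights_transfer) (auto simp: feasible_def)
  ultimately show ?thesis using assms(6) by (simp add: feasible_def)
qed

lemma not_optimal_if_edge_cheaper:
  assumes "optimal m f" "feasible m' f'" "\<And>e. e \<in> E \<Longrightarrow> f' e powr \<alpha> \<le> f e powr \<alpha>"
    and "e \<in> E" "f' e powr \<alpha> < f e powr \<alpha>"
  shows False
proof -
  have "cost f' < cost f" unfolding cost_def
    using assms len_pos finite_E
    by (intro sum_strict_mono_ex1) (auto intro!: mult_right_mono less_imp_le bexI[of _ e])
  then show False using assms unfolding optimal_def by fastforce
qed

text \<open>For \<open>\<alpha> = 0\<close> each used edge costs its length whatever its weight, so
  the other edges may even gain weight; otherwise monotonicity of the power requires that no weight
  grows.\<close>

lemma not_optimal_if_edge_vanishes: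
  assumes "optimal m f" "feasible m' f'" "\<alpha> = 0 \<or> (\<forall>e\<in>E. f' e \<le> f e)" "e \<in> E" "f' e = 0"
  shows False
proof (rule not_optimal_if_edge_cheaper[OF assms(1,2) _ assms(4)])
  have f: "f d > 0" if "d \<in> E" for d using assms that by (auto simp: optimal_def)
  have f': "f' d \<ge> 0" if "d \<in> E" for d using assms that by (auto simp: feasible_def)
  show "f' d powr \<alpha> \<le> f d powr \<alpha>" if "d \<in> E" for d
    using assms(3)
  proof
    assume "\<alpha> = 0"
    then show ?thesis using f[OF that] by simp
  next
    assume "\<forall>e\<in>E. f' e \<le> f e"
    then show ?thesis using f'[OF that] that alpha by (intro powr_mono2) auto
  qed
  show "f' e powr \<alpha> < f e powr \<alpha>" using assms f[of e] by simp
qed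

text \<open>Discrete divergence theorem: regroup the edges by their tail and by their head.\<close>

lemma netflow_sum:
  assumes "finite W"
  shows "(\<Sum>v\<in>W. netflow E f v)
    = (\<Sum>e \<in> {e \<in> E. fst e \<in> W}. f e) - (\<Sum>e \<in> {e \<in> E. snd e \<in> W}. f e)"
proof -
  have "(\<Sum>v\<in>W. \<Sum>e \<in> {e \<in> E. g e = v}. f e) = (\<Sum>e \<in> {e \<in> E. g e \<in> W}. f e)"
    for g :: "'a \<times> 'a \<Rightarrow> 'a"
  proof -
    have "(\<Sum>v\<in>W. \<Sum>e \<in> {e \<in> {e \<in> E. g e \<in> W}. g e = v}. f e) = (\<Sum>e \<in> {e \<in> E. g e \<in> W}. f e)"
      using finite_E assms by (intro sum.group) auto
    moreover have "(\<Sum>v\<in>W. \<Sum>e \<in> {e \<in> {e \<in> E. g e \<in> W}. g e = v}. f e)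
        = (\<Sum>v\<in>W. \<Sum>e \<in> {e \<in> E. g e = v}. f e)"
      by (intro sum.cong refl) auto
    ultimately show ?thesis by simp
  qed
  then show ?thesis by (simp add: netflow_def sum_subtractf)
qed

text \<open>If no mass sits upstream of \<open>v\<close>, then the flow upstream of \<open>v\<close> is a closed circulation,
  and deleting it makes the network cheaper.\<close>

lemma upstream_source:
  assumes opt: "optimal m f" and v: "(v, u) \<in> E \<union> E\<inverse>"
  obtains (source) p where "p \<in> {1..k}" "m p > 0" "(x p, v) \<in> E\<^sup>*"
proof (rule ccontr)
  assume "\<not> thesis"
  then have none: "\<not> (m p > 0 \<and> (x p, v) \<in> E\<^sup>*)" if "p \<in> {1..k}" for p
    using that source by blast
  define W where "W = {z \<in> V. (z, v) \<in> E\<^sup>*}"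
  have finW: "finite W" using finite_V by (simp add: W_def)
  have vW: "v \<in> W" using v E_subset by (auto simp: W_def)
  have feas: "feasible m f" and fpos: "\<And>e. e \<in> E \<Longrightarrow> f e > 0"
    using opt by (auto simp: optimal_def)
  \<comment> \<open>\<open>W\<close> is closed under predecessors, so no edge enters it from
    outside.\<close>
  have up: "fst e \<in> W" if "e \<in> E" "snd e \<in> W" for e
    using that E_subset by (cases e) (auto simp: W_def intro: converse_rtrancl_into_rtrancl)
  have mass: "atomic_mass k m x z = 0" if "z \<in> W" for z
    unfolding atomic_mass_def
  proof (intro sum.neutral ballI)
    fix p assume p: "p \<in> {1..k}"
    show "m p * indicat_real {z} (x p) = 0"
    proof (cases "x p = z")
      case True
      then have "\<not> m p > 0" using none[OF p] that by (auto simp: W_def)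
      moreover have "m p \<ge> 0" using feas p by (auto simp: feasible_def probability_weights_def)
      ultimately show ?thesis by simp
    qed simp
  qed
  have nf: "netflow E f z = - B z" if "z \<in> W" for z
    using feas mass[OF that] that by (auto simp: feasible_def W_def)
  have split: "(\<Sum>e \<in> {e \<in> E. fst e \<in> W}. f e)
      = (\<Sum>e \<in> {e \<in> E. snd e \<in> W}. f e) + (\<Sum>e \<in> {e \<in> E. fst e \<in> W \<and> snd e \<notin> W}. f e)"
    using finite_E up by (subst sum.union_disjoint[symmetric]) (auto intro!: sum.cong)
  have "(\<Sum>z\<in>W. netflow E f z) = (\<Sum>e \<in> {e \<in> E. fst e \<in> W \<and> snd e \<notin> W}. f e)"
    using netflow_sum[OF finW] split by simp
  \<comment> \<open>Without sources in \<open>W\<close>, the demand in \<open>W\<close> and the flow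
    leaving \<open>W\<close> sum to 0. Both are nonnegative, hence both vanish.\<close>
  then have total: "(\<Sum>z\<in>W. B z) + (\<Sum>e \<in> {e \<in> E. fst e \<in> W \<and> snd e \<notin> W}. f e) = 0"
    using nf by (simp add: sum_negf)
  have "(\<Sum>z\<in>W. B z) \<ge> 0" by (intro sum_nonneg B_nonneg)
  moreover have "(\<Sum>e \<in> {e \<in> E. fst e \<in> W \<and> snd e \<notin> W}. f e) \<ge> 0"
    using fpos by (intro sum_nonneg) (auto intro: less_imp_le)
  ultimately have "(\<Sum>z\<in>W. B z) = 0" "(\<Sum>e \<in> {e \<in> E. fst e \<in> W \<and> snd e \<notin> W}. f e) = 0"
    using total by linarith+
  then have B0: "\<forall>z\<in>W. B z = 0" and "\<forall>e\<in>{e \<in> E. fst e \<in> W \<and> snd e \<notin> W}. f e = 0"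
    using finW finite_E fpos B_nonneg
    by (subst (asm) sum_nonneg_eq_0_iff; force intro: less_imp_le)+
  \<comment> \<open>Weights are positive, so no edge leaves \<open>W\<close> at all:
    \<open>W\<close> is cut off from the rest and its flow can be erased.\<close>
  then have down: "snd e \<in> W" if "e \<in> E" "fst e \<in> W" for e using that fpos[of e] by force
  define g where "g e = (if fst e \<in> W then 0 else f e)" for e
  have "netflow E g z = atomic_mass k m x z - B z" if z: "z \<in> V" for z
  proof (cases "z \<in> W")
    case True
    then have "netflow E g z = 0" using up by (auto simp: netflow_def g_def intro!: sum.neutral)
    then show ?thesis using mass[OF True] B0 True by simp
  next
    case False
    then have "netflow E g z = netflow E f z" unfolding netflow_def
      using down by (intro arg_cong2[of _ _ _ _ "(-)"] sum.cong) (auto simp: g_def)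
    then show ?thesis using feas z by (simp add: feasible_def)
  qed
  moreover have gle: "\<forall>e\<in>E. g e \<ge> 0" "\<forall>e\<in>E. g e \<le> f e" using fpos by (auto simp: g_def less_imp_le)
  ultimately have "feasible m g" using feas by (simp add: feasible_def)
  \<comment> \<open>Whichever way the edge at \<open>v\<close> points, its tail lies in
    \<open>W\<close>.\<close>
  moreover obtain e where "e \<in> E" "g e = 0" using v vW up[of "(u, v)"] by (auto simp: g_def)
  ultimately show False using not_optimal_if_edge_vanishes opt gle by blast
qed

lemma undirected_path_first_edge:
  assumes "(a, b) \<in> (E \<union> E\<inverse>)\<^sup>*" "a \<noteq> b"
  obtains u where "(a, u) \<in> E \<union> E\<inverse>"
  using assms by (meson converse_rtranclE)

lemma connected_sym: "(a, b) \<in> (E \<union> E\<inverse>)\<^sup>* \<longleftrightarrow> (b, a) \<in> (E \<union> E\<inverse>)\<^sup>*"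
  by (metis Un_commute converse_Un converse_converse rtrancl_converseI)

lemma x_eq_iff: "i \<in> {1..k} \<Longrightarrow> p \<in> {1..k} \<Longrightarrow> x i = x p \<longleftrightarrow> i = p"
  using inj_x by (auto dest: inj_onD)

section \<open>The case of positive exponent\<close>

text \<open>If \<open>m i = 0\<close>, the source upstream of \<open>x i\<close> is some other
  \<open>x p\<close>. Supplying a little mass from \<open>x i\<close> instead only lowers weights,
  along a directed path from \<open>x p\<close> to \<open>x i\<close>.\<close>

lemma connected_source_positive:
  assumes opt: "optimal m f" and "\<alpha> > 0" and i: "i \<in> {1..k}"
    and conn: "(x i, b) \<in> (E \<union> E\<inverse>)\<^sup>*" "x i \<noteq> b"
  shows "m i > 0"
proof (rule ccontr)
  assume "\<not> m i > 0"
  obtain u where "(x i, u) \<in> E \<union> E\<inverse>" using undirected_path_first_edge[OF conn] .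
  from upstream_source[OF opt this] obtain p
    where p: "p \<in> {1..k}" "m p > 0" "(x p, x i) \<in> E\<^sup>*" .
  have "i \<noteq> p" using p \<open>\<not> m i > 0\<close> by auto
  have feas: "feasible m f" and fpos: "\<And>e. e \<in> E \<Longrightarrow> f e > 0"
    using opt by (auto simp: optimal_def)
  have mi: "m i \<ge> 0" using feas i by (auto simp: feasible_def probability_weights_def)
  obtain c where c: "\<And>e. c e \<ge> 0"
    "\<And>z. netflow E c z = indicat_real {x p} z - indicat_real {x i} z"
    using directed_path_chain[OF finite_E p(3)] by blast
  have "netflow E c (x p) \<noteq> 0" using \<open>i \<noteq> p\<close> x_eq_iff[OF i p(1)] by (simp add: c indicator_def)
  then obtain e where e: "e \<in> E" "c e \<noteq> 0" by (rule netflow_nonzeroE)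
  obtain t where t: "0 < t" "t \<le> m p" "\<And>e. e \<in> E \<Longrightarrow> t * \<bar>c e\<bar> \<le> f e"
    using exists_small_step[where w = f and c = c, OF finite_E fpos p(2)] by blast
  \<comment> \<open>\<open>c\<close> runs from \<open>x p\<close> to \<open>x i\<close>, while the
    transfer to \<open>i\<close> needs a chain in the opposite sense.\<close>
  have nc: "netflow E (\<lambda>e. - c e) z = indicat_real {x i} z - indicat_real {x p} z" for z
    using netflow_scale[of E "-1" c z] c(2)[of z] by simp
  have nonneg: "f d + t * - c d \<ge> 0" if "d \<in> E" for d using t(3)[OF that] c(1)[of d] by simp
  have feas': "feasible (transfer i p t m) (\<lambda>e. f e + t * - c e)"
    using feas i p(1) \<open>i \<noteq> p\<close> nc nonneg by (rule feasible_transfer) (use mi t in auto)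
  show False
  proof (rule not_optimal_if_edge_cheaper[OF opt feas' _ e(1)])
    show "(f d + t * - c d) powr \<alpha> \<le> f d powr \<alpha>" if "d \<in> E" for d
      using nonneg[OF that] c(1)[of d] t(1) \<open>\<alpha> > 0\<close> by (intro powr_mono2) auto
    have "t * c e > 0" using e c(1)[of e] t(1) by (simp add: less_le)
    then show "(f e + t * - c e) powr \<alpha> < f e powr \<alpha>"
      using nonneg[OF e(1)] \<open>\<alpha> > 0\<close> by (intro powr_less_mono2) auto
  qed
qed

text \<open>Both sources carry mass, so \<open>f\<close> is the midpoint of two feasible flows, and
  strict concavity makes one of them cheaper.\<close>

lemma sources_not_connected_pos:
  assumes opt: "optimal m f" and "\<alpha> > 0"
    and i: "i \<in> {1..k}" and p: "p \<in> {1..k}" and "i \<noteq> p"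
  shows "(x i, x p) \<notin> (E \<union> E\<inverse>)\<^sup>*"
proof
  assume conn: "(x i, x p) \<in> (E \<union> E\<inverse>)\<^sup>*"
  have ne: "x i \<noteq> x p" using x_eq_iff[OF i p] \<open>i \<noteq> p\<close> by simp
  have mi: "m i > 0" using connected_source_positive[OF opt \<open>\<alpha> > 0\<close> i conn ne] .
  have mp: "m p > 0"
    using connected_source_positive[OF opt \<open>\<alpha> > 0\<close> p] conn ne connected_sym by metis
  have feas: "feasible m f" and fpos: "\<And>e. e \<in> E \<Longrightarrow> f e > 0"
    using opt by (auto simp: optimal_def)
  obtain c where c: "\<And>z. netflow E c z = indicat_real {x i} z - indicat_real {x p} z"
    using undirected_path_chain[OF finite_E conn] by blast
  have "netflow E c (x i) \<noteq> 0" using ne by (simp add: c indicator_def)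
  then obtain e where e: "e \<in> E" "c e \<noteq> 0" by (rule netflow_nonzeroE)
  \<comment> \<open>The minimum keeps both masses nonnegative for the step \<open>t\<close> as well
    as for \<open>- t\<close>.\<close>
  obtain t where t: "0 < t" "t \<le> min (m i) (m p)" "\<And>e. e \<in> E \<Longrightarrow> t * \<bar>c e\<bar> \<le> f e"
    using exists_small_step[where w = f and c = c and T = "min (m i) (m p)", OF finite_E fpos] mi mp by auto
  have abs_le: "\<bar>t * c d\<bar> \<le> f d" if "d \<in> E" for d using t(3)[OF that] t(1) by (simp add: abs_mult)
  have "feasible (transfer i p t m) (\<lambda>e. f e + t * c e)"
    using feas i p \<open>i \<noteq> p\<close> c
    by (rule feasible_transfer) (use mi mp t abs_le in \<open>force simp: abs_le_iff\<close>)+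
  then have plus: "cost f \<le> cost (\<lambda>e. f e + t * c e)" using opt by (simp add: optimal_def)
  have "feasible (transfer i p (- t) m) (\<lambda>e. f e + - t * c e)"
    using feas i p \<open>i \<noteq> p\<close> c
    by (rule feasible_transfer) (use mi mp t abs_le in \<open>force simp: abs_le_iff\<close>)+
  then have minus: "cost f \<le> cost (\<lambda>e. f e - t * c e)" using opt by (simp add: optimal_def)
  have strict: "(f d + t * c d) powr \<alpha> * len d + (f d - t * c d) powr \<alpha> * len d < 2 * (f d powr \<alpha> * len d)"
    if "d \<in> E" "c d \<noteq> 0" for d
  proof -
    have "(f d + t * c d) powr \<alpha> + (f d - t * c d) powr \<alpha> < 2 * f d powr \<alpha>"
      using that abs_le[OF that(1)] fpos[OF that(1)] t(1) alpha \<open>\<alpha> > 0\<close> by (intro powr_midpoint_less) auto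
    then have "((f d + t * c d) powr \<alpha> + (f d - t * c d) powr \<alpha>) * len d < 2 * f d powr \<alpha> * len d"
      using len_pos[OF that(1)] by (rule mult_strict_right_mono)
    then show ?thesis by (simp add: algebra_simps)
  qed
  have "(\<Sum>d\<in>E. (f d + t * c d) powr \<alpha> * len d + (f d - t * c d) powr \<alpha> * len d)
      < (\<Sum>d\<in>E. 2 * (f d powr \<alpha> * len d))"
  proof (rule sum_strict_mono_ex1[OF finite_E])
    show "\<forall>d\<in>E. (f d + t * c d) powr \<alpha> * len d + (f d - t * c d) powr \<alpha> * len d
        \<le> 2 * (f d powr \<alpha> * len d)"
    proof
      fix d assume "d \<in> E"
      then show "(f d + t * c d) powr \<alpha> * len d + (f d - t * c d) powr \<alpha> * len d
        \<le> 2 * (f d powr \<alpha> * len d)"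
        using strict[of d] by (cases "c d = 0") auto
    qed
    show "\<exists>d\<in>E. (f d + t * c d) powr \<alpha> * len d + (f d - t * c d) powr \<alpha> * len d
        < 2 * (f d powr \<alpha> * len d)"
      using strict e by blast
  qed
  then have "cost (\<lambda>e. f e + t * c e) + cost (\<lambda>e. f e - t * c e) < 2 * cost f"
    by (simp add: cost_def sum.distrib sum_distrib_left)
  then show False using plus minus by simp
qed

section \<open>The case of exponent zero\<close>

text \<open>For \<open>\<alpha> = 0\<close> moving mass inside a component costs nothing as long as no edge vanishes,
  and no edge can vanish on the way.\<close>

lemma optimal_transfer_all:
  assumes opt: "optimal m f" and "\<alpha> = 0"
    and i: "i \<in> {1..k}" and p: "p \<in> {1..k}" and "i \<noteq> p"
    and conn: "(x i, x p) \<in> (E \<union> E\<inverse>)\<^sup>*"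
  obtains f' where "optimal (transfer i p (m p) m) f'"
proof -
  have feas: "feasible m f" and fpos: "\<And>e. e \<in> E \<Longrightarrow> f e > 0"
    using opt by (auto simp: optimal_def)
  have nn: "m i \<ge> 0" "m p \<ge> 0" using feas i p by (auto simp: feasible_def probability_weights_def)
  obtain c where c: "\<And>z. netflow E c z = indicat_real {x i} z - indicat_real {x p} z"
    using undirected_path_chain[OF finite_E conn] by blast
  have pos: "f e + m p * c e > 0" if "e \<in> E" for e
  proof (rule ccontr)
    assume "\<not> ?thesis"
    then have "f e + m p * c e \<le> 0" by simp
    \<comment> \<open>Stopping when the first edge reaches 0 moves at most \<open>m p\<close>, so it
      is feasible and loses an edge.\<close>
    from exists_step_to_boundary[where w = f and c = c, OF finite_E fpos that this nn(2)] obtain t d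
      where t: "0 < t" "t \<le> m p" "\<And>e. e \<in> E \<Longrightarrow> f e + t * c e \<ge> 0" "d \<in> E" "f d + t * c d = 0"
      by metis
    have "feasible (transfer i p t m) (\<lambda>e. f e + t * c e)"
      using feas i p \<open>i \<noteq> p\<close> c t(3) by (rule feasible_transfer) (use nn t in auto)
    then show False
      by (rule not_optimal_if_edge_vanishes[OF opt]) (use t \<open>\<alpha> = 0\<close> in auto)
  qed
  have "feasible (transfer i p (m p) m) (\<lambda>e. f e + m p * c e)"
    using feas i p \<open>i \<noteq> p\<close> c less_imp_le[OF pos] by (rule feasible_transfer) (use nn in auto)
  \<comment> \<open>Both flows are positive on all of \<open>E\<close>, so both cost its total
    length.\<close>
  moreover have "cost (\<lambda>e. f e + m p * c e) = cost f"
    unfolding cost_def using pos fpos \<open>\<alpha> = 0\<close> by (intro sum.cong) force+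
  ultimately have "optimal (transfer i p (m p) m) (\<lambda>e. f e + m p * c e)"
    using opt pos by (simp add: optimal_def)
  then show ?thesis by (rule that)
qed

text \<open>The other sources are emptied into \<open>x i\<close> one at a time; each transfer
  yields an optimal flow on the same edges, so the next one can follow.\<close>

lemma optimal_concentrated:
  assumes opt: "optimal m f" and "\<alpha> = 0" and i: "i \<in> {1..k}"
  obtains m' f' where "optimal m' f'"
    "\<And>p. p \<in> {1..k} \<Longrightarrow> p \<noteq> i \<Longrightarrow> (x i, x p) \<in> (E \<union> E\<inverse>)\<^sup>* \<Longrightarrow> m' p = 0"
proof -
  define P where "P = {p \<in> {1..k}. p \<noteq> i \<and> (x i, x p) \<in> (E \<union> E\<inverse>)\<^sup>*}"
  have "finite P" by (simp add: P_def)
  have "\<exists>m' f'. optimal m' f' \<and> (\<forall>p\<in>Q. m' p = 0)" if "Q \<subseteq> P" for Q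
    using finite_subset[OF that \<open>finite P\<close>] that
  proof (induction Q rule: finite_induct)
    case empty
    then show ?case using opt by blast
  next
    case (insert p Q)
    then obtain m' f' where m': "optimal m' f'" "\<forall>p\<in>Q. m' p = 0" by auto
    have p: "p \<in> {1..k}" "i \<noteq> p" "(x i, x p) \<in> (E \<union> E\<inverse>)\<^sup>*" "i \<notin> Q"
      using insert.prems by (auto simp: P_def)
    obtain g where "optimal (transfer i p (m' p) m') g"
      using optimal_transfer_all[OF m'(1) \<open>\<alpha> = 0\<close> i p(1-3)] by blast
    moreover have "\<forall>q\<in>insert p Q. transfer i p (m' p) m' q = 0"
      using m'(2) p by (auto simp: transfer_def)
    ultimately show ?case by blast
  qed
  from this[of P] show ?thesis using that by (auto simp: P_def)
qed

text \<open>Once \<open>x i\<close> holds all the mass of its component, it is the only possible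
  source upstream of \<open>x s\<close>. The edge set has not changed, so the path lies in the
  original graph.\<close>

lemma directed_path_between_sources:
  assumes opt: "optimal m f" and "\<alpha> = 0"
    and i: "i \<in> {1..k}" and s: "s \<in> {1..k}" and "i \<noteq> s"
    and conn: "(x i, x s) \<in> (E \<union> E\<inverse>)\<^sup>*"
  shows "(x i, x s) \<in> E\<^sup>*"
proof -
  obtain m' f' where m': "optimal m' f'"
    "\<And>p. p \<in> {1..k} \<Longrightarrow> p \<noteq> i \<Longrightarrow> (x i, x p) \<in> (E \<union> E\<inverse>)\<^sup>* \<Longrightarrow> m' p = 0"
    using optimal_concentrated[OF opt \<open>\<alpha> = 0\<close> i] by blast
  have "x s \<noteq> x i" using x_eq_iff[OF i s] \<open>i \<noteq> s\<close> by simp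
  then obtain u where "(x s, u) \<in> E \<union> E\<inverse>"
    using undirected_path_first_edge conn connected_sym by metis
  from upstream_source[OF m'(1) this] obtain p
    where p: "p \<in> {1..k}" "m' p > 0" "(x p, x s) \<in> E\<^sup>*" .
  have "(x p, x s) \<in> (E \<union> E\<inverse>)\<^sup>*" using p(3) by (meson Un_upper1 in_mono rtrancl_mono)
  then have "(x i, x p) \<in> (E \<union> E\<inverse>)\<^sup>*" using conn connected_sym by (meson rtrancl_trans)
  then have "p = i" using m'(2)[OF p(1)] p(2) by force
  then show ?thesis using p(3) by simp
qed

lemma sources_not_connected_zero:
  assumes opt: "optimal m f" and "\<alpha> = 0"
    and i: "i \<in> {1..k}" and s: "s \<in> {1..k}" and "i \<noteq> s"
  shows "(x i, x s) \<notin> (E \<union> E\<inverse>)\<^sup>*"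
proof
  assume conn: "(x i, x s) \<in> (E \<union> E\<inverse>)\<^sup>*"
  have feas: "feasible m f" and fpos: "\<And>e. e \<in> E \<Longrightarrow> f e > 0"
    using opt by (auto simp: optimal_def)
  have "(x i, x s) \<in> E\<^sup>*" "(x s, x i) \<in> E\<^sup>*"
    using directed_path_between_sources[OF opt \<open>\<alpha> = 0\<close>] i s \<open>i \<noteq> s\<close> conn connected_sym by metis+
  then obtain c d where c: "\<And>e. c e \<ge> 0" "\<And>z. netflow E c z = indicat_real {x i} z - indicat_real {x s} z"
    and d: "\<And>e. d e \<ge> 0" "\<And>z. netflow E d z = indicat_real {x s} z - indicat_real {x i} z"
    using directed_path_chain[OF finite_E] by metis
  have "netflow E c (x i) \<noteq> 0" using \<open>i \<noteq> s\<close> x_eq_iff[OF i s] by (simp add: c indicator_def)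
  then obtain e where e: "e \<in> E" "c e \<noteq> 0" by (rule netflow_nonzeroE)
  \<comment> \<open>The two directed chains close up to a nonnegative circulation; \<open>h\<close>
    is its negative and leaves every netflow unchanged.\<close>
  define h where "h e = (- 1) * (c e + d e)" for e
  have "netflow E h z = 0" for z
    unfolding h_def netflow_scale netflow_add by (simp add: c d)
  then have nh: "netflow E (\<lambda>e. f e + t * h e) z = netflow E f z" for t z
    by (simp add: netflow_add netflow_scale)
  have "h e < 0" using e c(1)[of e] d(1)[of e] by (simp add: h_def)
  \<comment> \<open>The time \<open>f e / - h e\<close> at which \<open>e\<close> itself would
    vanish bounds the step.\<close>
  then have "f e + (f e / - h e) * h e \<le> 0" "f e / - h e \<ge> 0"
    using fpos[OF e(1)] by (simp_all add: divide_nonneg_neg field_simps)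
  from exists_step_to_boundary[where w = f and c = h, OF finite_E fpos e(1) this] obtain t e'
    where t: "0 < t" "\<And>e. e \<in> E \<Longrightarrow> f e + t * h e \<ge> 0" "e' \<in> E" "f e' + t * h e' = 0"
    by metis
  have "feasible m (\<lambda>e. f e + t * h e)" using feas t(2) by (simp add: feasible_def nh)
  then show False by (rule not_optimal_if_edge_vanishes[OF opt]) (use t \<open>\<alpha> = 0\<close> in auto)
qed

lemma sources_not_connected:
  assumes "optimal m f" "i \<in> {1..k}" "s \<in> {1..k}" "i \<noteq> s"
  shows "(x i, x s) \<notin> (E \<union> E\<inverse>)\<^sup>*"
  using assms sources_not_connected_pos sources_not_connected_zero alpha(1)
  by (cases "\<alpha> = 0") auto

end

section \<open>From transport paths to networks and back\<close>

text \<open>A loop is a cycle of length 1; its absence gives every edge positive length.\<close>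

lemma no_loop_if_acyclic:
  assumes "\<not> has_undirected_cycle G"
  shows "(v, v) \<notin> parcs G"
proof
  assume "(v, v) \<in> parcs G"
  then have "has_undirected_cycle G" unfolding has_undirected_cycle_def
    by (intro exI[of _ "[v]"] exI[of _ "[(v, v)]"]) auto
  then show False using assms by simp
qed

lemma has_undirected_cycle_mono:
  "has_undirected_cycle G \<Longrightarrow> parcs G \<subseteq> parcs H \<Longrightarrow> has_undirected_cycle H"
  unfolding has_undirected_cycle_def by (meson subset_trans)

lemma transport_paths_netflow:
  "(G, w) \<in> transport_paths k m x l n y \<longleftrightarrow>
     pair_fin_digraph G \<and> x ` {1..k} \<union> y ` {1..l} \<subseteq> pverts G \<and> (\<forall>e \<in> parcs G. w e > 0) \<and>
     (\<forall>v \<in> pverts G. netflow (parcs G) w v = atomic_mass k m x v - atomic_mass l n y v) \<and>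
     \<not> has_undirected_cycle G"
proof -
  have "(\<Sum>e \<in> out_arcs (with_proj G) v. w e)
      = (\<Sum>e \<in> in_arcs (with_proj G) v. w e) + atomic_mass k m x v - atomic_mass l n y v
    \<longleftrightarrow> netflow (parcs G) w v = atomic_mass k m x v - atomic_mass l n y v" for v
    unfolding netflow_def in_arcs_def out_arcs_def with_proj_simps by linarith
  then show ?thesis unfolding transport_paths_def by simp
qed

lemma connected_components_rtrancl:
  assumes "C \<in> connected_components G" "u \<in> C" "v \<in> C"
  shows "(u, v) \<in> (parcs G \<union> (parcs G)\<inverse>)\<^sup>*"
proof -
  have "u \<rightarrow>\<^sup>*\<^bsub>with_proj (mk_symmetric (with_proj G))\<^esub> v"
    using assms by (auto simp: connected_components_def pre_digraph.sccs_verts_def)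
  then have "(u, v) \<in> (parcs (mk_symmetric (with_proj G)))\<^sup>*"
    unfolding reachable_def by (auto dest: rtrancl_on_rtranclI)
  moreover have "parcs (mk_symmetric (with_proj G)) \<subseteq> parcs G \<union> (parcs G)\<inverse>"
    by (auto simp: parcs_mk_symmetric)
  ultimately show ?thesis by (meson in_mono rtrancl_mono)
qed

theorem lemma3p2:
  fixes X :: "(real ^ 'm) set"
    and x y :: "nat \<Rightarrow> real ^ 'm"
    and n :: "nat \<Rightarrow> real"
    and k l i s :: nat
    and \<alpha> :: real
    and G :: "(real ^ 'm) pair_pre_digraph"
    and w :: "(real ^ 'm) \<times> (real ^ 'm) \<Rightarrow> real"
  assumes "compact X" and "convex X"
    and "x ` {1..k} \<subseteq> X" and "inj_on x {1..k}"
    and "y ` {1..l} \<subseteq> X"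
    and "\<forall>j \<in> {1..l}. n j > 0" and "(\<Sum>j = 1..l. n j) = 1"
    and "0 \<le> \<alpha>" and "\<alpha> < 1"
    and "optimal_allocation_path \<alpha> k x l n y (G, w)"
    and "i \<in> {1..k}" and "s \<in> {1..k}" and "i \<noteq> s"
  shows "\<not> (\<exists>C \<in> connected_components G. x i \<in> C \<and> x s \<in> C)"
proof -
  obtain m where m: "probability_weights k m" "(G, w) \<in> transport_paths k m x l n y"
    using assms(10) by (auto simp: optimal_allocation_path_def allocation_paths_def)
  have G: "pair_fin_digraph G" "x ` {1..k} \<union> y ` {1..l} \<subseteq> pverts G" "\<forall>e \<in> parcs G. w e > 0"
    "\<forall>v \<in> pverts G. netflow (parcs G) w v = atomic_mass k m x v - atomic_mass l n y v"
    "\<not> has_undirected_cycle G"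
    using m(2) by (simp_all add: transport_paths_netflow)
  interpret pair_fin_digraph G by (fact G(1))
  interpret N: allocation_network "pverts G" "parcs G" "\<lambda>e. dist (fst e) (snd e)" \<alpha> k x "atomic_mass l n y"
  proof
    show "parcs G \<subseteq> pverts G \<times> pverts G" using arc_fst_in_verts arc_snd_in_verts by force
    show "0 < dist (fst e) (snd e)" if "e \<in> parcs G" for e
      using that no_loop_if_acyclic[OF G(5)] by (cases e) auto
    show "0 \<le> atomic_mass l n y v" for v
      using assms(6) unfolding atomic_mass_def by (intro sum_nonneg mult_nonneg_nonneg) (auto intro: less_imp_le)
  qed (use G assms pair_finite_verts pair_finite_arcs in auto)
  have "M_cost \<alpha> (G, w) \<le> N.cost f" if f: "N.feasible m' f" for m' f
  proof -
    \<comment> \<open>Transport paths need positive weights, so edges of weight 0 are removed while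
      all vertices stay.\<close>
    define H where "H = G\<lparr>parcs := {e \<in> parcs G. f e > 0}\<rparr>"
    have zero: "f e = 0" if "e \<in> parcs G" "\<not> f e > 0" for e
      using f that by (force simp: N.feasible_def)
    have H: "pverts H = pverts G" "parcs H = {e \<in> parcs G. f e > 0}" by (simp_all add: H_def)
    have "pair_fin_digraph H"
      by unfold_locales
        (auto simp: H arc_fst_in_verts arc_snd_in_verts pair_finite_verts pair_finite_arcs
          dest: in_arcsD1 in_arcsD2)
    moreover have "netflow (parcs H) f v = netflow (parcs G) f v" for v
      unfolding netflow_def H using zero pair_finite_arcs
      by (intro arg_cong2[of _ _ _ _ "(-)"] sum.mono_neutral_left) auto
    moreover have "\<not> has_undirected_cycle H"
      using G(5) has_undirected_cycle_mono[of H G] by (auto simp: H)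
    ultimately have "(H, f) \<in> transport_paths k m' x l n y"
      using f G(2) by (simp add: transport_paths_netflow N.feasible_def H)
    then have "(H, f) \<in> allocation_paths k x l n y"
      using f by (auto simp: allocation_paths_def N.feasible_def)
    then have "M_cost \<alpha> (G, w) \<le> M_cost \<alpha> (H, f)"
      using assms(10) by (simp add: optimal_allocation_path_def)
    \<comment> \<open>The removed edges contribute 0 on the right, also for
      \<open>\<alpha> = 0\<close>, since \<open>0 powr 0 = 0\<close>.\<close>
    also have "M_cost \<alpha> (H, f) = N.cost f"
      unfolding M_cost_def N.cost_def H prod.case using zero pair_finite_arcs
      by (intro sum.mono_neutral_left) auto
    finally show ?thesis .
  qed
  then have "N.optimal m w"
    using m(1) G by (auto simp: N.optimal_def N.feasible_def N.cost_def M_cost_def less_imp_le)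
  then have "(x i, x s) \<notin> (parcs G \<union> (parcs G)\<inverse>)\<^sup>*"
    using N.sources_not_connected assms(11-13) by simp
  then show ?thesis using connected_components_rtrancl[of _ G "x i" "x s"] by metis
qed

end
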